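(* In the setting described in the context (a Jackson network in a random environment with combined jump rates $R[(z,\underline n),(z',\underline n')]$ on $\mathcal Z\times\mathbb Z_+^\Lambda$): (I) The measure $\kappa$ on $\mathcal Z\times\mathbb Z_+^\Lambda$ given by $$\kappa(z,\underline n)=\frac{1}{\sigma(z)}\prod_{i\in\Lambda}\left(\frac{\rho_i^{(z)}}{\mu_i^{(z)}}\right)^{n_i},\qquad z\in\mathcal Z,\ \underline n=(n_i)\in\mathbb Z_+^\Lambda,$$ and the collection of rates $R$ satisfy the weak invariance equation (WIE), i.e. for all $(z,\underline n)\in\mathcal Z\times\mathbb Z_+^\Lambda$ $$\sum_{(z',\underline n')\ne(z,\underline n)}\kappa(z,\underline n)R[(z,\underline n),(z',\underline n')]=\sum_{(z',\underline n')\ne(z,\underline n)}\kappa(z',\underline n')R[(z',\underline n'),(z,\underline n)].$$ (II) Assume that $\rho_i^{(z)}/\mu_i^{(z)}<1$ for all $i\in\Lambda$, $z\in\mathcal Z$, and $$\Xi:=\sum_{z\in\mathcal Z}\frac{1}{\sigma(z)}\prod_{i\in\Lambda}\left(1-\frac{\rho_i^{(z)}}{\mu_i^{(z)}}\right)^{-1}<\infty .$$ Then $$\pi(z,\underline n)=\frac{1}{\Xi\,\sigma(z)}\prod_{i\in\Lambda}\left(\frac{\rho_i^{(z)}}{\mu_i^{(z)}}\right)^{n_i}$$ is a probability measure on $\mathcal Z\times\mathbb Z_+^\Lambda$ which satisfies the WIE with the rates $R$.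
   Context: $\Lambda$ is a finite set (sites), $\mathcal Z$ is a finite or countable set (states of environment), $\mathbb Z_+=\{0,1,2,\dots\}$. For each $z\in\mathcal Z$ the following are given: numbers $\lambda_i^{(z)}\ge 0$ and $\mu_i^{(z)}>0$ ($i\in\Lambda$), and a sub-stochastic matrix $\mathtt P^{(z)}=(p_{ik}^{(z)})_{i,k\in\Lambda}$, that is, $p^{(z)}_{ik}\ge0$ and $\sum_k p^{(z)}_{ik}\le 1$; put $p_i^{*(z)}=1-\sum_{k\in\Lambda}p_{ik}^{(z)}$. It is assumed that $\mathtt P^{(z)}$ is irreducible (some power $(\mathtt P^{(z)})^s$, $s\geq 1$, has strictly positive entries) and that $\mathtt I-\mathtt P^{(z)}$ is invertible. The row vector $\underline\rho^{(z)}=(\rho_i^{(z)})_{i\in\Lambda}$ is defined by $\underline\rho^{(z)}=\underline\lambda^{(z)}(\mathtt I-\mathtt P^{(z)})^{-1}$, with $\underline\lambda^{(z)}=(\lambda_i^{(z)})$, and it is assumed that $\rho_i^{(z)}>0$ for all $i,z$. Further data: $\alpha(z)\in[0,\infty)$ and $\sigma(z)\in(0,\infty)$ for $z\in\mathcal Z$; and, for each $\underline n\in\mathbb Z_+^\Lambda$, numbers $\tau^{(\underline n)}(z,z')\ge0$ ($z,z'\in\mathcal Z$) with $\tau^{(\underline n)}(z,z)=0$ and $\sum_{z'\in\mathcal Z}\tau^{(\underline n)}(z,z')=\sum_{z'\in\mathcal Z}\tau^{(\underline n)}(z',z)$ for all $z\in\mathcal Z$. Let $\underline e^i\in\mathbb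 Z_+^\Lambda$ be the unit vector at $i$ and $\underline e^{i\to k}=\underline e^k-\underline e^i$. The combined jump rates between distinct states of $\mathcal Z\times\mathbb Z_+^\Lambda$ are - $R[(z,\underline n),(z,\underline n+\underline e^i)]=\alpha(z)\lambda_i^{(z)}$, $i\in\Lambda$; - $R[(z,\underline n),(z,\underline n-\underline e^i)]=\alpha(z)\mu_i^{(z)}p_i^{*(z)}\mathbf 1(n_i\ge1)$, $i\in\Lambda$; - $R[(z,\underline n),(z,\underline n+\underline e^{i\to k})]=\alpha(z)\mu_i^{(z)}p_{ik}^{(z)}\mathbf 1(n_i\ge1)$, $i\neq k$ in $\Lambda$; - $R[(z,\underline n),(z',\underline n)]=\sigma(z)\,\tau^{(\underline n)}(z,z')\prod_{i\in\Lambda}\big(\rho_i^{(z)}/\mu_i^{(z)}\big)^{-n_i}$, $z'\ne z$; - $R[(z,\underline n),(z',\underline n')]=0$ for all other pairs of distinct states. (The diagonal entries $R[(z,\underline n),(z,\underline n)]$ are minus the sums of the off-diagonal row entries and do not enter the WIE.) Sums of non-negative terms are understood in $[0,\infty]$. *)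

theory Defs
  imports "HOL-Analysis.Analysis" "HOL-Probability.Probability_Measure"
begin

text \<open>
  The sites are the elements of a finite type \<open>'l\<close>, the states of the environment those of a
  countable type \<open>'z\<close>. A configuration of the network is a vector \<open>n :: nat ^ 'l\<close>; the unit
  vector at \<open>i\<close> is \<open>axis i 1\<close>.
\<close>

text \<open>The class operations \<open>*\<close> and \<open>^\<close> on \<open>real ^ 'l ^ 'l\<close> are not the matrix ones, hence the
  iterated \<open>**\<close>.\<close>

definition matrix_power :: "real ^ 'l ^ 'l \<Rightarrow> nat \<Rightarrow> real ^ 'l ^ 'l" where
  "matrix_power A s = (((**) A) ^^ s) (mat 1)"

definition substochastic :: "real ^ 'l ^ 'l \<Rightarrow> bool" where
  "substochastic A \<longleftrightarrow> (\<forall>i k. 0 \<le> A $ i $ k) \<and> (\<forall>i. (\<Sum>k\<in>UNIV. A $ i $ k) \<le> 1)"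

text \<open>Irreducibility in the sense that one and the same power has all entries positive.\<close>

definition irreducible_matrix :: "real ^ 'l ^ 'l \<Rightarrow> bool" where
  "irreducible_matrix A \<longleftrightarrow> (\<exists>s\<ge>1. \<forall>i k. 0 < matrix_power A s $ i $ k)"

definition exit_prob :: "real ^ 'l ^ 'l \<Rightarrow> 'l \<Rightarrow> real" where
  "exit_prob A i = 1 - (\<Sum>k\<in>UNIV. A $ i $ k)"

definition traffic :: "real ^ 'l \<Rightarrow> real ^ 'l ^ 'l \<Rightarrow> real ^ 'l" where
  "traffic l A = l v* matrix_inv (mat 1 - A)"

text \<open>
  Jump rates \<open>R s s'\<close> between distinct states of a countable set and a mass function \<open>m\<close>. All sums
  are taken in \<open>[0, \<infinity>]\<close>, where every family is summable; rates and masses are meant to be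
  non-negative, and values on the diagonal play no role.
\<close>

definition WIE :: "('s \<Rightarrow> real) \<Rightarrow> ('s \<Rightarrow> 's \<Rightarrow> real) \<Rightarrow> bool" where
  "WIE m R \<longleftrightarrow> (\<forall>s. (\<Sum>\<^sub>\<infinity>s'\<in>UNIV - {s}. ennreal (m s * R s s'))
                   = (\<Sum>\<^sub>\<infinity>s'\<in>UNIV - {s}. ennreal (m s' * R s' s)))"

locale jackson_environment =
  fixes lam mu :: "'z::countable \<Rightarrow> real ^ 'l::finite"
    and P :: "'z \<Rightarrow> real ^ 'l ^ 'l"
    and \<alpha> \<sigma> :: "'z \<Rightarrow> real"
    and \<tau> :: "nat ^ 'l \<Rightarrow> 'z \<Rightarrow> 'z \<Rightarrow> real"
  assumes lam_nonneg: "0 \<le> lam z $ i"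
    and mu_pos: "0 < mu z $ i"
    and P_substochastic: "substochastic (P z)"
    and P_irreducible: "irreducible_matrix (P z)"
    and I_minus_P_invertible: "invertible (mat 1 - P z)"
    and rho_pos: "0 < traffic (lam z) (P z) $ i"
    and alpha_nonneg: "0 \<le> \<alpha> z"
    and sigma_pos: "0 < \<sigma> z"
    and tau_nonneg: "0 \<le> \<tau> n z z'"
    and tau_diag: "\<tau> n z z = 0"
    and tau_balanced: "(\<Sum>\<^sub>\<infinity>z'\<in>UNIV. ennreal (\<tau> n z z')) = (\<Sum>\<^sub>\<infinity>z'\<in>UNIV. ennreal (\<tau> n z' z))"

definition load :: "('z \<Rightarrow> real ^ 'l) \<Rightarrow> ('z \<Rightarrow> real ^ 'l) \<Rightarrow> ('z \<Rightarrow> real ^ 'l ^ 'l) \<Rightarrow> 'z \<Rightarrow> 'l \<Rightarrow> real" where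
  "load lam mu P z i = traffic (lam z) (P z) $ i / mu z $ i"

text \<open>
  In the first branch at most one of the \<open>of_bool\<close> terms is non-zero, so the sums merely select the
  rate listed for the pair of states in question (see the lemmas below). The subtraction
  \<open>n - axis i 1\<close> truncates at \<open>0\<close>, but is only used under the guard \<open>1 \<le> n $ i\<close>.
\<close>

definition jackson_rate ::
  "('z \<Rightarrow> real ^ 'l::finite) \<Rightarrow> ('z \<Rightarrow> real ^ 'l) \<Rightarrow> ('z \<Rightarrow> real ^ 'l ^ 'l) \<Rightarrow> ('z \<Rightarrow> real) \<Rightarrow> ('z \<Rightarrow> real)
    \<Rightarrow> (nat ^ 'l \<Rightarrow> 'z \<Rightarrow> 'z \<Rightarrow> real) \<Rightarrow> 'z \<times> (nat ^ 'l) \<Rightarrow> 'z \<times> (nat ^ 'l) \<Rightarrow> real" where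
  "jackson_rate lam mu P \<alpha> \<sigma> \<tau> = (\<lambda>(z, n) (z', n').
     if z' = z then
         (\<Sum>i\<in>UNIV. \<alpha> z * lam z $ i * of_bool (n' = n + axis i 1))
       + (\<Sum>i\<in>UNIV. \<alpha> z * mu z $ i * exit_prob (P z) i
            * of_bool (1 \<le> n $ i \<and> n' = n - axis i 1))
       + (\<Sum>i\<in>UNIV. \<Sum>k\<in>UNIV - {i}. \<alpha> z * mu z $ i * P z $ i $ k
            * of_bool (1 \<le> n $ i \<and> n' = n - axis i 1 + axis k 1))
     else if n' = n then
       \<sigma> z * \<tau> n z z' * (\<Prod>i\<in>UNIV. load lam mu P z i powi (- int (n $ i)))
     else 0)"

definition jackson_kappa ::
  "('z \<Rightarrow> real ^ 'l::finite) \<Rightarrow> ('z \<Rightarrow> real ^ 'l) \<Rightarrow> ('z \<Rightarrow> real ^ 'l ^ 'l) \<Rightarrow> ('z \<Rightarrow> real)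
    \<Rightarrow> 'z \<times> (nat ^ 'l) \<Rightarrow> real" where
  "jackson_kappa lam mu P \<sigma> = (\<lambda>(z, n). 1 / \<sigma> z * (\<Prod>i\<in>UNIV. load lam mu P z i ^ (n $ i)))"

definition jackson_Xi ::
  "('z \<Rightarrow> real ^ 'l::finite) \<Rightarrow> ('z \<Rightarrow> real ^ 'l) \<Rightarrow> ('z \<Rightarrow> real ^ 'l ^ 'l) \<Rightarrow> ('z \<Rightarrow> real) \<Rightarrow> ennreal" where
  "jackson_Xi lam mu P \<sigma> =
     (\<Sum>\<^sub>\<infinity>z\<in>UNIV. ennreal (1 / \<sigma> z * (\<Prod>i\<in>UNIV. inverse (1 - load lam mu P z i))))"

text \<open>Only of interest when \<open>jackson_Xi\<close> is finite.\<close>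

definition jackson_pi ::
  "('z \<Rightarrow> real ^ 'l::finite) \<Rightarrow> ('z \<Rightarrow> real ^ 'l) \<Rightarrow> ('z \<Rightarrow> real ^ 'l ^ 'l) \<Rightarrow> ('z \<Rightarrow> real)
    \<Rightarrow> 'z \<times> (nat ^ 'l) \<Rightarrow> real" where
  "jackson_pi lam mu P \<sigma> = (\<lambda>(z, n).
     1 / (enn2real (jackson_Xi lam mu P \<sigma>) * \<sigma> z) * (\<Prod>i\<in>UNIV. load lam mu P z i ^ (n $ i)))"

text \<open>The values of \<open>jackson_rate\<close> on the various kinds of pairs of states.\<close>

lemma sum_add_axis: "(\<Sum>j\<in>UNIV. (n + axis i 1) $ j) = (\<Sum>j\<in>UNIV. n $ j) + 1"
  for n :: "nat ^ 'l::finite"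
  by (simp add: sum.distrib axis_def)

lemma add_two_axes_neq: "n + axis i 1 + axis j 1 \<noteq> n + axis k 1" "n + axis i 1 + axis j 1 \<noteq> n"
  for n :: "nat ^ 'l::finite"
proof -
  let ?S = "\<lambda>v :: nat ^ 'l. \<Sum>l\<in>UNIV. v $ l"
  have "?S (n + axis i 1 + axis j 1) = ?S n + 2"
    using sum_add_axis[of "n + axis i 1" j] sum_add_axis[of n i] by linarith
  moreover have "?S (n + axis k 1) = ?S n + 1"
    by (rule sum_add_axis)
  ultimately have "?S (n + axis i 1 + axis j 1) \<noteq> ?S (n + axis k 1)" "?S (n + axis i 1 + axis j 1) \<noteq> ?S n"
    by linarith+
  then show "n + axis i 1 + axis j 1 \<noteq> n + axis k 1" "n + axis i 1 + axis j 1 \<noteq> n"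
    by metis+
qed

lemma axis_one_inj: "axis i (1::nat) = axis j 1 \<longleftrightarrow> i = j" for i j :: "'l::finite"
  by (metis axis_eq_axis zero_neq_one)

lemma departure_iff:
  "1 \<le> n $ i \<and> n' = n - axis i 1 \<longleftrightarrow> n' + axis i 1 = n" for n :: "nat ^ 'l::finite"
proof
  assume a: "1 \<le> n $ i \<and> n' = n - axis i 1"
  then show "n' + axis i 1 = n"
    by (auto simp: vec_eq_iff axis_def)
next
  assume "n' + axis i 1 = n"
  then have n: "n = n' + axis i 1" by simp
  show "1 \<le> n $ i \<and> n' = n - axis i 1"
    unfolding n by (auto simp: vec_eq_iff axis_def)
qed

lemma transfer_iff:
  fixes n :: "nat ^ 'l::finite"
  assumes "i \<noteq> k"
  shows "1 \<le> n $ i \<and> n' = n - axis i 1 + axis k 1 \<longleftrightarrow> n' + axis i 1 = n + axis k 1"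
proof
  assume a: "n' + axis i 1 = n + axis k 1"
  then have eq: "n' $ j + axis i 1 $ j = n $ j + axis k 1 $ j" for j
    by (metis vector_add_component)
  have 1: "1 \<le> n $ i"
    using eq[of i] assms by (simp add: axis_def)
  have "n' $ j = (n - axis i 1 + axis k 1) $ j" for j
    using eq[of j] 1 assms by (auto simp: axis_def split: if_splits)
  with 1 show "1 \<le> n $ i \<and> n' = n - axis i 1 + axis k 1"
    by (simp add: vec_eq_iff)
next
  assume a: "1 \<le> n $ i \<and> n' = n - axis i 1 + axis k 1"
  have "(n' + axis i 1) $ j = (n + axis k 1) $ j" for j
    using a assms by (auto simp: axis_def)
  then show "n' + axis i 1 = n + axis k 1"
    by (simp add: vec_eq_iff)
qed

lemma transfer_eq_iff:
  fixes a b i k :: "'l::finite"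
  assumes "i \<noteq> k"
  shows "axis a (1::nat) + axis k 1 = axis i 1 + axis b 1 \<and> a \<noteq> b \<longleftrightarrow> i = a \<and> k = b"
proof
  assume h: "axis a (1::nat) + axis k 1 = axis i 1 + axis b 1 \<and> a \<noteq> b"
  have eq: "axis a (1::nat) $ j + axis k 1 $ j = axis i 1 $ j + axis b 1 $ j" for j
    using h by (metis vector_add_component)
  show "i = a \<and> k = b"
    using eq[of a] eq[of b] h assms by (auto simp: axis_def split: if_splits)
qed (use assms in \<open>auto simp: add.commute\<close>)

lemma jackson_rate_same_env:
  "jackson_rate lam mu P \<alpha> \<sigma> \<tau> (z, n) (z, n') =
         (\<Sum>i\<in>UNIV. \<alpha> z * lam z $ i * of_bool (n' = n + axis i 1))
       + (\<Sum>i\<in>UNIV. \<alpha> z * mu z $ i * exit_prob (P z) i * of_bool (n' + axis i 1 = n))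
       + (\<Sum>i\<in>UNIV. \<Sum>k\<in>UNIV - {i}. \<alpha> z * mu z $ i * P z $ i $ k
            * of_bool (n' + axis i 1 = n + axis k 1))"
proof -
  have "(\<Sum>i\<in>UNIV. \<Sum>k\<in>UNIV - {i}. \<alpha> z * mu z $ i * P z $ i $ k
            * of_bool (1 \<le> n $ i \<and> n' = n - axis i 1 + axis k 1))
      = (\<Sum>i\<in>UNIV. \<Sum>k\<in>UNIV - {i}. \<alpha> z * mu z $ i * P z $ i $ k
            * of_bool (n' + axis i 1 = n + axis k 1))"
    by (intro sum.cong refl) (subst transfer_iff, auto)
  then show ?thesis
    unfolding jackson_rate_def by (simp only: departure_iff prod.case if_True simp_thms refl)
qed

lemma jackson_rate_arrival:
  "jackson_rate lam mu P \<alpha> \<sigma> \<tau> (z, n) (z, n + axis i 1) = \<alpha> z * lam z $ i"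
proof -
  have d: "n + axis i 1 + axis j 1 \<noteq> n" for j
    using add_two_axes_neq by metis
  have t: "n + axis i 1 + axis j 1 \<noteq> n + axis k 1" for j k
    using add_two_axes_neq by metis
  show ?thesis
    by (simp add: jackson_rate_same_env d t axis_one_inj of_bool_def if_distrib del: One_nat_def cong: if_cong)
qed

lemma jackson_rate_departure:
  assumes "1 \<le> n $ i"
  shows "jackson_rate lam mu P \<alpha> \<sigma> \<tau> (z, n) (z, n - axis i 1) = \<alpha> z * mu z $ i * exit_prob (P z) i"
proof -
  define m where "m = n - axis i 1"
  have n: "n = m + axis i 1"
    using assms departure_iff[of n i m] by (simp add: m_def)
  have a: "m \<noteq> m + axis i 1 + axis j 1" for j
    using add_two_axes_neq by metis
  have t: "m + axis j 1 \<noteq> m + axis i 1 + axis k 1" for j k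
    using add_two_axes_neq by metis
  show ?thesis
    unfolding m_def[symmetric] unfolding n
    by (simp add: jackson_rate_same_env a t axis_one_inj of_bool_def if_distrib del: One_nat_def cong: if_cong)
qed

lemma jackson_rate_transfer:
  assumes "1 \<le> n $ i" "i \<noteq> k"
  shows "jackson_rate lam mu P \<alpha> \<sigma> \<tau> (z, n) (z, n - axis i 1 + axis k 1) = \<alpha> z * mu z $ i * P z $ i $ k"
proof -
  define m where "m = n - axis i 1"
  have n: "n = m + axis i 1"
    using assms departure_iff[of n i m] by (simp add: m_def)
  have a: "m + axis k 1 \<noteq> m + axis i 1 + axis j 1" for j
    using add_two_axes_neq by metis
  have d: "m + axis k 1 + axis j 1 \<noteq> m + axis i 1" for j
    using add_two_axes_neq by metis
  have t: "m + axis k 1 + axis a 1 = m + axis i 1 + axis b 1 \<longleftrightarrow> i = a \<and> k = b" if "b \<in> UNIV - {a}" for a b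
    using transfer_eq_iff[OF assms(2), of a b] that by (simp add: add.assoc add.commute[of "axis k 1"] del: One_nat_def)
  have "(\<Sum>a\<in>UNIV. \<Sum>b\<in>UNIV - {a}. \<alpha> z * mu z $ a * P z $ a $ b
            * of_bool (m + axis k 1 + axis a 1 = m + axis i 1 + axis b 1))
      = (\<Sum>a\<in>UNIV. \<Sum>b\<in>UNIV - {a}. if i = a then (if k = b then \<alpha> z * mu z $ a * P z $ a $ b else 0) else 0)"
    by (intro sum.cong refl, subst t) auto
  also have "\<dots> = (\<Sum>a\<in>UNIV. if i = a then \<alpha> z * mu z $ a * P z $ a $ k else 0)"
    using assms(2) by (intro sum.cong refl) (auto simp: sum.delta)
  also have "\<dots> = \<alpha> z * mu z $ i * P z $ i $ k"
    by simp
  finally show ?thesis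
    unfolding m_def[symmetric] unfolding n
    unfolding jackson_rate_same_env by (simp add: a d del: One_nat_def)
qed

lemma jackson_rate_environment:
  assumes "z' \<noteq> z"
  shows "jackson_rate lam mu P \<alpha> \<sigma> \<tau> (z, n) (z', n) =
           \<sigma> z * \<tau> n z z' * (\<Prod>i\<in>UNIV. (traffic (lam z) (P z) $ i / mu z $ i) powi (- int (n $ i)))"
  using assms by (simp add: jackson_rate_def load_def)

lemma jackson_rate_other:
  assumes "z' = z \<Longrightarrow> (\<forall>i. n' \<noteq> n + axis i 1) \<and> (\<forall>i. 1 \<le> n $ i \<longrightarrow> n' \<noteq> n - axis i 1) \<and>
             (\<forall>i k. i \<noteq> k \<longrightarrow> 1 \<le> n $ i \<longrightarrow> n' \<noteq> n - axis i 1 + axis k 1)"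
    and "z' \<noteq> z \<Longrightarrow> n' \<noteq> n"
  shows "jackson_rate lam mu P \<alpha> \<sigma> \<tau> (z, n) (z', n') = 0"
proof (cases "z' = z")
  case True
  note h = assms(1)[OF True]
  have "of_bool (1 \<le> n $ i \<and> n' = n - axis i 1 + axis k 1) = (0::real)" if "k \<in> UNIV - {i}" for i k
    using h that by auto
  then have "(\<Sum>i\<in>UNIV. \<Sum>k\<in>UNIV - {i}. \<alpha> z * mu z $ i * P z $ i $ k
            * of_bool (1 \<le> n $ i \<and> n' = n - axis i 1 + axis k 1)) = 0"
    by (intro sum.neutral ballI) simp
  moreover have "(1 \<le> n $ i \<and> n' = n - axis i 1) = False" for i
    using h by blast
  ultimately show ?thesis
    using h True unfolding jackson_rate_def prod.case by (simp only: if_True of_bool_eq mult_zero_right sum.neutral_const simp_thms)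
qed (use assms(2) in \<open>simp add: jackson_rate_def\<close>)

lemma (in jackson_environment) jackson_rate_nonneg: "0 \<le> jackson_rate lam mu P \<alpha> \<sigma> \<tau> s s'"
proof -
  have [simp]: "0 \<le> exit_prob (P z) i" "0 \<le> P z $ i $ k" for z i k
    using P_substochastic[of z] by (auto simp: substochastic_def exit_prob_def)
  have [simp]: "0 \<le> load lam mu P z i" for z i
    using rho_pos[of z i] mu_pos[of z i] by (simp add: load_def)
  note [simp] = lam_nonneg mu_pos[THEN less_imp_le] alpha_nonneg sigma_pos[THEN less_imp_le] tau_nonneg
  show ?thesis
    by (cases s; cases s')
      (auto simp: jackson_rate_def intro!: add_nonneg_nonneg sum_nonneg mult_nonneg_nonneg prod_nonneg)
qed

end

(* The balance of flow splits into two separate balances. A change of environment out of (z,n) has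
   flow kappa(z,n) R[(z,n),(z',n)] = tau(z,z'), since the product of the loads in kappa cancels the
   one in the rate; these flows balance because tau does. Within a fixed environment, the in- and
   outflow are finite sums over arrivals, departures and transfers. After division by the common
   factor kappa(z,n) alpha(z) both equal
     sum_i lambda_i + sum_k 1(n_k >= 1) mu_k (1 - p_kk):
   for the inflow, use the traffic equation rho = lambda + rho P at each site, and its sum over all
   sites, sum_i rho_i p*_i = sum_i lambda_i. The mass of kappa is a product of geometric series. *)

theory Submission
  imports Defs
begin

section \<open>Unconditional sums\<close>

text \<open>Countability moves both sides to subsets of the naturals, where each is a series. This
  makes linearity and Tonelli for integrals available to sums in [0, infinity].\<close>

lemma nn_integral_count_space_eq_infsum:
  fixes f :: "'a::countable \<Rightarrow> ennreal"
  shows "(\<integral>\<^sup>+x. f x \<partial>count_space A) = infsum f A"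
proof -
  let ?g = "\<lambda>k. f (from_nat k) * indicator (to_nat ` A) k"
  have "(\<integral>\<^sup>+x. f x \<partial>count_space A) = (\<integral>\<^sup>+x. f (from_nat (to_nat x)) \<partial>count_space A)"
    by simp
  also have "\<dots> = (\<integral>\<^sup>+k. f (from_nat k) \<partial>count_space (to_nat ` A))"
    by (rule nn_integral_bij_count_space[of to_nat]) (simp add: bij_betw_def inj_on_def)
  also have "\<dots> = (\<integral>\<^sup>+k. ?g k \<partial>count_space UNIV)"
    by (auto simp: nn_integral_count_space_indicator)
  also have "\<dots> = (\<Sum>k. ?g k)"
    by (rule nn_integral_count_space_nat)
  also have "\<dots> = infsum ?g UNIV"
    using has_sum_imp_sums[OF has_sum_infsum[OF nonneg_summable_on_complete[of UNIV ?g]]]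
    by (intro sums_unique[symmetric]) simp
  also have "\<dots> = infsum (\<lambda>k. f (from_nat k)) (to_nat ` A)"
    by (rule infsum_cong_neutral) auto
  also have "\<dots> = infsum f A"
    by (subst infsum_reindex) (simp_all add: o_def inj_on_def)
  finally show ?thesis .
qed

lemma infsum_cmult_ennreal:
  fixes f :: "'a::countable \<Rightarrow> ennreal"
  shows "infsum (\<lambda>x. c * f x) A = c * infsum f A"
  by (simp add: nn_integral_count_space_eq_infsum[symmetric] nn_integral_cmult)

text \<open>Passes from sums computed in the reals to those in \<open>WIE\<close>:
  \<open>ennreal\<close> is continuous, and on non-negative terms it commutes with finite partial
  sums.\<close>

lemma infsum_ennreal_eqI:
  fixes f :: "'a \<Rightarrow> real"
  assumes "(f has_sum v) A" and "\<And>x. x \<in> A \<Longrightarrow> 0 \<le> f x"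
  shows "infsum (\<lambda>x. ennreal (f x)) A = ennreal v"
proof (rule infsumI)
  have "((\<lambda>F. ennreal (sum f F)) \<longlongrightarrow> ennreal v) (finite_subsets_at_top A)"
    using assms(1) unfolding has_sum_def by (rule tendsto_ennrealI)
  moreover have "\<forall>\<^sub>F F in finite_subsets_at_top A. ennreal (sum f F) = (\<Sum>x\<in>F. ennreal (f x))"
    by (rule eventually_finite_subsets_at_top_weakI) (use assms(2) in \<open>auto intro!: sum_ennreal[symmetric]\<close>)
  ultimately show "((\<lambda>x. ennreal (f x)) has_sum ennreal v) A"
    unfolding has_sum_def by (rule Lim_transform_eventually)
qed

text \<open>A jump of the combined process changes the environment or the configuration, never both.
  Only the two arms of a cross through (a, b) contribute, and without their centre they are
  disjoint.\<close>

lemma infsum_ennreal_cross: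
  fixes f :: "'a \<times> 'b \<Rightarrow> ennreal"
  assumes "\<And>x y. x \<noteq> a \<Longrightarrow> y \<noteq> b \<Longrightarrow> f (x, y) = 0"
  shows "infsum f (UNIV - {(a, b)})
       = (\<Sum>\<^sub>\<infinity>y\<in>UNIV - {b}. f (a, y)) + (\<Sum>\<^sub>\<infinity>x\<in>UNIV - {a}. f (x, b))"
proof -
  let ?A = "Pair a ` (UNIV - {b})" and ?B = "(\<lambda>x. (x, b)) ` (UNIV - {a})"
  have "infsum f (UNIV - {(a, b)}) = infsum f (?A \<union> ?B)"
  proof (rule infsum_cong_neutral)
    show "f s = 0" if "s \<in> UNIV - {(a, b)} - (?A \<union> ?B)" for s
      using that by (cases s) (auto intro: assms)
  qed auto
  also have "\<dots> = infsum f ?A + infsum f ?B"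
    by (rule infsum_Un_disjoint) (auto intro: nonneg_summable_on_complete)
  also have "\<dots> = (\<Sum>\<^sub>\<infinity>y\<in>UNIV - {b}. f (a, y)) + (\<Sum>\<^sub>\<infinity>x\<in>UNIV - {a}. f (x, b))"
    by (simp add: infsum_reindex inj_on_def o_def)
  finally show ?thesis .
qed

lemma has_sum_sum:
  fixes f :: "'i \<Rightarrow> 'a \<Rightarrow> 'b::topological_comm_monoid_add"
  assumes "\<And>i. i \<in> I \<Longrightarrow> (f i has_sum v i) A"
  shows "((\<lambda>x. \<Sum>i\<in>I. f i x) has_sum (\<Sum>i\<in>I. v i)) A"
  \<comment> \<open>For infinite \<open>I\<close> the finite sums on both sides are 0 by
    convention.\<close>
  using assms by (induction I rule: infinite_finite_induct) (auto intro: has_sum_add)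

lemma sum_off_diagonal_swap:
  fixes f :: "'i::finite \<Rightarrow> 'i \<Rightarrow> 'b::comm_monoid_add"
  shows "(\<Sum>i\<in>UNIV. \<Sum>k\<in>UNIV - {i}. f i k) = (\<Sum>k\<in>UNIV. \<Sum>i\<in>UNIV - {k}. f i k)"
proof -
  have "UNIV - {i} = {k \<in> UNIV. k \<noteq> i}" "UNIV - {i} = {k \<in> UNIV. i \<noteq> k}" for i :: 'i
    by auto
  then show ?thesis
    using sum.swap_restrict[of UNIV UNIV f "\<lambda>i k. k \<noteq> i"] by simp
qed

lemma has_sum_remove_zero:
  assumes "(f has_sum v) UNIV" and "f n = 0"
  shows "(f has_sum v) (UNIV - {n})"
  using assms by (subst has_sum_cong_neutral[of UNIV _ f f]) auto

lemma has_sum_of_bool_eq: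
  fixes g :: "'a \<Rightarrow> real"
  shows "((\<lambda>x. g x * of_bool (x = a)) has_sum g a) UNIV"
  by (rule has_sum_finite_neutralI[of "{a}"]) auto

text \<open>Adding a unit vector is injective, and m is in its range exactly when its coordinate i
  is positive; so at most one term survives.\<close>

lemma has_sum_of_bool_add_axis:
  fixes g :: "nat ^ 'l::finite \<Rightarrow> real"
  shows "((\<lambda>x. g x * of_bool (x + axis i 1 = m)) has_sum of_bool (1 \<le> m $ i) * g (m - axis i 1)) UNIV"
proof -
  have "x + axis i 1 = m \<longleftrightarrow> 1 \<le> m $ i \<and> x = m - axis i 1" for x
    by (rule departure_iff[symmetric])
  then show ?thesis
    using has_sum_of_bool_eq[of g "m - axis i 1"] by (cases "1 \<le> m $ i") (simp_all del: One_nat_def)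
qed

lemma WIE_cmult:
  fixes m :: "'s::countable \<Rightarrow> real"
  assumes "0 \<le> c" and "WIE m R"
  shows "WIE (\<lambda>s. c * m s) R"
  using assms unfolding WIE_def
  by (simp add: ennreal_mult' infsum_cmult_ennreal mult.assoc)

text \<open>A configuration is a free choice of one exponent per site, so the sum factors into
  geometric series, one for each site.\<close>

lemma infsum_prod_power:
  fixes x :: "'l::finite \<Rightarrow> real"
  assumes "\<And>i. 0 \<le> x i" and "\<And>i. x i < 1"
  shows "(\<Sum>\<^sub>\<infinity>n. ennreal (\<Prod>i\<in>UNIV. x i ^ ((n :: nat ^ 'l) $ i))) = ennreal (\<Prod>i\<in>UNIV. inverse (1 - x i))"
proof -
  let ?f = "\<lambda>g :: 'l \<Rightarrow> nat. \<Prod>i\<in>UNIV. x i ^ g i"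
  have geo: "((\<lambda>k. x i ^ k) has_sum inverse (1 - x i)) UNIV" for i
    using assms[of i] geometric_sums[of "x i"]
    by (intro norm_summable_imp_has_sum) (auto simp: divide_inverse)
  have "infsum ?f (PiE UNIV (\<lambda>_. UNIV)) = (\<Prod>i\<in>UNIV. infsum (\<lambda>k. x i ^ k) UNIV)"
    using assms geo by (intro infsum_prod_PiE_abs) (auto simp: summable_on_def)
  then have inf: "infsum ?f UNIV = (\<Prod>i\<in>UNIV. inverse (1 - x i))"
    using infsumI[OF geo] by simp
  \<comment> \<open>\<open>infsum\<close> is 0 for a real family that is not summable, so a strictly
    positive value proves summability.\<close>
  moreover have "0 < (\<Prod>i\<in>UNIV. inverse (1 - x i))"
    using assms by (intro prod_pos) auto
  ultimately have "?f summable_on UNIV"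
    using infsum_not_exists[of ?f UNIV] by (metis less_irrefl)
  with inf have "(?f has_sum (\<Prod>i\<in>UNIV. inverse (1 - x i))) UNIV"
    by (metis has_sum_infsum)
  moreover have "bij_betw vec_nth (UNIV :: (nat ^ 'l) set) UNIV"
    by (rule bij_betwI[of _ _ _ vec_lambda]) auto
  ultimately have *: "((\<lambda>n :: nat ^ 'l. ?f (vec_nth n)) has_sum (\<Prod>i\<in>UNIV. inverse (1 - x i))) UNIV"
    using has_sum_reindex_bij_betw[of vec_nth UNIV UNIV ?f] by simp
  then show ?thesis
    using assms(1) by (intro infsum_ennreal_eqI[OF *]) (auto intro!: prod_nonneg)
qed

section \<open>The invariance equation\<close>

text \<open>Multiplying the definition of \<open>traffic\<close> on the right by
  \<open>mat 1 - A\<close> removes the inverse.\<close>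

lemma traffic_equation:
  assumes "invertible (mat 1 - A)"
  shows "traffic l A $ k = l $ k + (\<Sum>i\<in>UNIV. traffic l A $ i * A $ i $ k)"
proof -
  \<comment> \<open>\<open>matrix_inv\<close> chooses some two-sided inverse; invertibility
    guarantees that there is one to choose.\<close>
  have "matrix_inv (mat 1 - A) ** (mat 1 - A) = mat 1"
    using assms unfolding invertible_def matrix_inv_def by (rule someI2_ex) auto
  then have "traffic l A v* (mat 1 - A) = l"
    by (simp add: traffic_def vector_matrix_mul_assoc)
  then have "traffic l A = l + traffic l A v* A"
    by (simp add: vector_matrix_mult_diff_rdistrib algebra_simps)
  then have "traffic l A $ k = l $ k + (traffic l A v* A) $ k"
    by (metis vector_add_component)
  then show ?thesis
    by (simp add: vector_matrix_mult_def mult.commute)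
qed

section \<open>Product weights and their change under unit steps\<close>

context jackson_environment
begin

abbreviation "\<rho> z \<equiv> traffic (lam z) (P z)"
text \<open>This is \<open>jackson_kappa\<close> without the factor \<open>1 / \<sigma> z\<close>,
  which is constant as long as the environment is.\<close>

abbreviation "weight z n \<equiv> \<Prod>i\<in>UNIV. load lam mu P z i ^ (n $ i)"
abbreviation "rate \<equiv> jackson_rate lam mu P \<alpha> \<sigma> \<tau>"

lemma load_pos: "0 < load lam mu P z i"
  using rho_pos mu_pos by (simp add: load_def)

lemma weight_pos: "0 < weight z n"
  by (intro prod_pos) (simp add: load_pos)

lemma weight_add_axis: "weight z (n + axis i 1) = weight z n * load lam mu P z i"
proof -
  have "weight z (n + axis i 1) = weight z n * (\<Prod>j\<in>UNIV. load lam mu P z j ^ (axis i 1 $ j))"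
    by (simp add: power_add prod.distrib)
  also have "(\<Prod>j\<in>UNIV. load lam mu P z j ^ (axis i 1 $ j)) = (\<Prod>j\<in>UNIV. if j = i then load lam mu P z j else 1)"
    by (intro prod.cong) (auto simp: axis_def)
  finally show ?thesis by simp
qed

lemma weight_diff_axis:
  assumes "1 \<le> n $ i"
  shows "weight z (n - axis i 1) = weight z n / load lam mu P z i"
proof -
  have "n - axis i 1 + axis i 1 = n"
    using assms departure_iff by metis
  then show ?thesis
    using weight_add_axis[of z "n - axis i 1" i] load_pos[of z i] by (simp add: field_simps)
qed

section \<open>Network flows in a fixed environment\<close>

lemma sum_exit_flow: "(\<Sum>i\<in>UNIV. \<rho> z $ i * exit_prob (P z) i) = (\<Sum>i\<in>UNIV. lam z $ i)"
proof -
  have "(\<Sum>i\<in>UNIV. \<rho> z $ i * exit_prob (P z) i)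
      = (\<Sum>i\<in>UNIV. \<rho> z $ i) - (\<Sum>i\<in>UNIV. \<Sum>k\<in>UNIV. \<rho> z $ i * P z $ i $ k)"
    by (simp add: exit_prob_def right_diff_distrib sum_subtractf sum_distrib_left)
  also have "(\<Sum>i\<in>UNIV. \<Sum>k\<in>UNIV. \<rho> z $ i * P z $ i $ k) = (\<Sum>k\<in>UNIV. \<Sum>i\<in>UNIV. \<rho> z $ i * P z $ i $ k)"
    by (rule sum.swap)
  \<comment> \<open>After the swap, the inner sum over origins is component k of the vector rho P,
    which the traffic equation evaluates.\<close>
  also have "\<dots> = (\<Sum>k\<in>UNIV. \<rho> z $ k - lam z $ k)"
  proof (intro sum.cong refl)
    show "(\<Sum>i\<in>UNIV. \<rho> z $ i * P z $ i $ k) = \<rho> z $ k - lam z $ k" for k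
      using traffic_equation[OF I_minus_P_invertible, of "lam z" z k] by linarith
  qed
  finally show ?thesis by (simp add: sum_subtractf)
qed

text \<open>The total rate of network jumps out of n. A job fed back to its own site causes no jump,
  hence \<open>1 - P z $ k $ k\<close> in place of 1.\<close>

definition exit_rate :: "'z \<Rightarrow> nat ^ 'l \<Rightarrow> real" where
  "exit_rate z n = \<alpha> z * ((\<Sum>i\<in>UNIV. lam z $ i)
                         + (\<Sum>k\<in>UNIV. of_bool (1 \<le> n $ k) * mu z $ k * (1 - P z $ k $ k)))"

text \<open>With value 0 on the diagonal, sums over the other configurations can be computed over
  \<open>UNIV\<close>.\<close>

lemma rate_diagonal: "rate (z, n) (z, n) = 0"
proof -
  have "axis i 1 \<noteq> axis k (1::nat)" if "k \<in> UNIV - {i}" for i k :: 'l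
    using that by (simp add: axis_one_inj del: One_nat_def)
  moreover have "axis i 1 \<noteq> (0 :: nat ^ 'l)" for i
    by (simp add: axis_def vec_eq_iff)
  ultimately show ?thesis
    unfolding jackson_rate_same_env by (simp del: One_nat_def)
qed

text \<open>Each arrival, departure or transfer out of n has a single target, so the sum collapses
  to finite sums over sites. It is evaluated in the reals, where subtraction is available.\<close>

lemma network_outflow:
  "((\<lambda>n'. weight z n * rate (z, n) (z, n')) has_sum weight z n * exit_rate z n) (UNIV - {n})"
proof (rule has_sum_remove_zero)
  let ?b = "\<lambda>i. of_bool (1 \<le> n $ i) :: real"
  \<comment> \<open>The indicator lemma yields the guard for \<open>n + axis k 1\<close>; away from
    site k it is the guard for n.\<close>
  have *: "(n + axis k 1) $ i = n $ i" if "k \<in> UNIV - {i}" for i k :: 'l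
    using that by (simp add: axis_def)
  \<comment> \<open>Leaving the network or moving to another site has total probability
    \<open>1 - P z $ i $ i\<close>.\<close>
  have d: "mu z $ i * exit_prob (P z) i + (\<Sum>k\<in>UNIV - {i}. mu z $ i * P z $ i $ k) = mu z $ i * (1 - P z $ i $ i)" for i
    by (simp add: exit_prob_def sum.remove[of UNIV i "\<lambda>k. P z $ i $ k"] sum_distrib_left[symmetric] algebra_simps)
  have rates: "((\<lambda>x. rate (z, n) (z, x)) has_sum (\<Sum>i\<in>UNIV. \<alpha> z * lam z $ i)
       + (\<Sum>i\<in>UNIV. ?b i * (\<alpha> z * mu z $ i * exit_prob (P z) i))
       + (\<Sum>i\<in>UNIV. \<Sum>k\<in>UNIV - {i}. ?b i * (\<alpha> z * mu z $ i * P z $ i $ k))) UNIV"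
    unfolding jackson_rate_same_env
  proof (intro has_sum_add has_sum_sum has_sum_of_bool_eq has_sum_of_bool_add_axis)
    fix i k :: 'l assume "k \<in> UNIV - {i}"
    then show "((\<lambda>x. \<alpha> z * mu z $ i * P z $ i $ k * of_bool (x + axis i 1 = n + axis k 1))
        has_sum ?b i * (\<alpha> z * mu z $ i * P z $ i $ k)) UNIV"
      using has_sum_of_bool_add_axis[of "\<lambda>_. \<alpha> z * mu z $ i * P z $ i $ k" i "n + axis k 1"]
      by (simp only: *)
  qed
  have "(\<Sum>i\<in>UNIV. \<alpha> z * lam z $ i)
       + (\<Sum>i\<in>UNIV. ?b i * (\<alpha> z * mu z $ i * exit_prob (P z) i))
       + (\<Sum>i\<in>UNIV. \<Sum>k\<in>UNIV - {i}. ?b i * (\<alpha> z * mu z $ i * P z $ i $ k))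
     = \<alpha> z * (\<Sum>i\<in>UNIV. lam z $ i) + (\<Sum>i\<in>UNIV. ?b i * \<alpha> z *
         (mu z $ i * exit_prob (P z) i + (\<Sum>k\<in>UNIV - {i}. mu z $ i * P z $ i $ k)))"
    by (simp add: sum_distrib_left distrib_left sum.distrib mult_ac del: One_nat_def)
  also have "\<dots> = exit_rate z n"
    unfolding d exit_rate_def by (simp add: sum_distrib_left distrib_left mult_ac del: One_nat_def)
  finally show "((\<lambda>n'. weight z n * rate (z, n) (z, n')) has_sum weight z n * exit_rate z n) UNIV"
    using has_sum_cmult_right[OF rates, of "weight z n"] by simp
qed (simp add: rate_diagonal)

text \<open>Seen from the target n, the guards change sides: an arrival needs a job at site i for
  its source \<open>n - axis i 1\<close> to exist, a transfer needs one at its destination, and a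
  departure has the source \<open>n + axis i 1\<close> in any case. A step up in the weight
  contributes a load, which turns \<open>mu\<close> into \<open>\<rho>\<close>.\<close>

lemma network_inflow:
  "((\<lambda>n'. weight z n' * rate (z, n') (z, n)) has_sum weight z n * exit_rate z n) (UNIV - {n})"
proof (rule has_sum_remove_zero)
  let ?b = "\<lambda>i. of_bool (1 \<le> n $ i) :: real"
  let ?x = "load lam mu P z"
  have *: "(n + axis i 1) $ k = n $ k" if "k \<in> UNIV - {i}" for i k :: 'l
    using that by (simp add: axis_def)
  have rho: "?x i * mu z $ i = \<rho> z $ i" for i
    using mu_pos[of z i] by (simp add: load_def)
  \<comment> \<open>Arrivals at k and transfers into k share the factor \<open>1 / ?x k\<close>.
    Their total comes from the traffic equation at k with its diagonal term moved to the
    left.\<close>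
  have d: "?b k * lam z $ k / ?x k + (\<Sum>i\<in>UNIV - {k}. ?b k * \<rho> z $ i * P z $ i $ k / ?x k)
      = ?b k * mu z $ k * (1 - P z $ k $ k)" for k
  proof -
    have "\<rho> z $ k = lam z $ k + (\<rho> z $ k * P z $ k $ k + (\<Sum>i\<in>UNIV - {k}. \<rho> z $ i * P z $ i $ k))"
      using traffic_equation[OF I_minus_P_invertible, of "lam z" z k]
      by (simp add: sum.remove[of UNIV k "\<lambda>i. \<rho> z $ i * P z $ i $ k"])
    then have "lam z $ k + (\<Sum>i\<in>UNIV - {k}. \<rho> z $ i * P z $ i $ k) = ?x k * (mu z $ k * (1 - P z $ k $ k))"
      by (simp add: rho[symmetric] algebra_simps)
    then have "?b k / ?x k * (lam z $ k + (\<Sum>i\<in>UNIV - {k}. \<rho> z $ i * P z $ i $ k))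
        = ?b k * mu z $ k * (1 - P z $ k $ k)"
      using load_pos[of z k] by simp
    then show ?thesis
      by (simp add: distrib_left sum_distrib_left mult_ac del: One_nat_def)
  qed
  \<comment> \<open>The indicators are turned towards the source x, now the variable of
    summation.\<close>
  have expand: "weight z x * rate (z, x) (z, n) =
      (\<Sum>i\<in>UNIV. \<alpha> z * lam z $ i * (weight z x * of_bool (x + axis i 1 = n)))
    + (\<Sum>i\<in>UNIV. \<alpha> z * mu z $ i * exit_prob (P z) i * (weight z x * of_bool (x = n + axis i 1)))
    + (\<Sum>i\<in>UNIV. \<Sum>k\<in>UNIV - {i}. \<alpha> z * mu z $ i * P z $ i $ k
         * (weight z x * of_bool (x + axis k 1 = n + axis i 1)))" for x
    unfolding jackson_rate_same_env distrib_left sum_distrib_left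
    by (simp add: mult_ac eq_commute)
  have rates: "((\<lambda>x. weight z x * rate (z, x) (z, n)) has_sum
      (\<Sum>i\<in>UNIV. \<alpha> z * lam z $ i * (?b i * weight z (n - axis i 1)))
    + (\<Sum>i\<in>UNIV. \<alpha> z * mu z $ i * exit_prob (P z) i * weight z (n + axis i 1))
    + (\<Sum>i\<in>UNIV. \<Sum>k\<in>UNIV - {i}. \<alpha> z * mu z $ i * P z $ i $ k
         * (?b k * weight z (n + axis i 1 - axis k 1)))) UNIV"
    unfolding expand
  proof (intro has_sum_add has_sum_sum has_sum_cmult_right has_sum_of_bool_eq has_sum_of_bool_add_axis)
    fix i k :: 'l assume "k \<in> UNIV - {i}"
    then show "((\<lambda>x. weight z x * of_bool (x + axis k 1 = n + axis i 1))
        has_sum ?b k * weight z (n + axis i 1 - axis k 1)) UNIV"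
      using has_sum_of_bool_add_axis[of "weight z" k "n + axis i 1"] by (simp only: *)
  qed
  have "(\<Sum>i\<in>UNIV. \<alpha> z * lam z $ i * (?b i * weight z (n - axis i 1)))
      = (\<Sum>k\<in>UNIV. weight z n * \<alpha> z * (?b k * lam z $ k / ?x k))"
    by (intro sum.cong) (auto simp: weight_diff_axis simp del: One_nat_def vector_minus_component)
  moreover have "(\<Sum>i\<in>UNIV. \<alpha> z * mu z $ i * exit_prob (P z) i * weight z (n + axis i 1))
      = (\<Sum>i\<in>UNIV. weight z n * \<alpha> z * (\<rho> z $ i * exit_prob (P z) i))"
    by (intro sum.cong) (auto simp: weight_add_axis rho[symmetric] simp del: One_nat_def vector_add_component)
  moreover have "(\<Sum>i\<in>UNIV. \<Sum>k\<in>UNIV - {i}. \<alpha> z * mu z $ i * P z $ i $ k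
         * (?b k * weight z (n + axis i 1 - axis k 1)))
      = (\<Sum>i\<in>UNIV. \<Sum>k\<in>UNIV - {i}. weight z n * \<alpha> z * (?b k * \<rho> z $ i * P z $ i $ k / ?x k))"
  proof (intro sum.cong refl)
    fix i k :: 'l assume "k \<in> UNIV - {i}"
    \<comment> \<open>When \<open>?b k\<close> is 1, the truncated subtraction at k is exact, since
      the job added at i leaves coordinate k alone; when it is 0, both sides vanish.\<close>
    then have "?b k * weight z (n + axis i 1 - axis k 1) = ?b k * (weight z n * ?x i / ?x k)"
      using weight_diff_axis[of "n + axis i 1" k z] * weight_add_axis[of z n i] by auto
    then show "\<alpha> z * mu z $ i * P z $ i $ k * (?b k * weight z (n + axis i 1 - axis k 1))
        = weight z n * \<alpha> z * (?b k * \<rho> z $ i * P z $ i $ k / ?x k)"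
      by (simp only: rho[symmetric]) simp
  qed
  \<comment> \<open>Transfers are regrouped by their destination, the index by which
    \<open>d\<close> collects them.\<close>
  moreover have "(\<Sum>i\<in>UNIV. \<Sum>k\<in>UNIV - {i}. ?b k * \<rho> z $ i * P z $ i $ k / ?x k)
      = (\<Sum>k\<in>UNIV. \<Sum>i\<in>UNIV - {k}. ?b k * \<rho> z $ i * P z $ i $ k / ?x k)"
    by (rule sum_off_diagonal_swap)
  ultimately have "(\<Sum>i\<in>UNIV. \<alpha> z * lam z $ i * (?b i * weight z (n - axis i 1)))
    + (\<Sum>i\<in>UNIV. \<alpha> z * mu z $ i * exit_prob (P z) i * weight z (n + axis i 1))
    + (\<Sum>i\<in>UNIV. \<Sum>k\<in>UNIV - {i}. \<alpha> z * mu z $ i * P z $ i $ k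
         * (?b k * weight z (n + axis i 1 - axis k 1)))
    = weight z n * \<alpha> z * ((\<Sum>i\<in>UNIV. \<rho> z $ i * exit_prob (P z) i)
      + (\<Sum>k\<in>UNIV. ?b k * lam z $ k / ?x k + (\<Sum>i\<in>UNIV - {k}. ?b k * \<rho> z $ i * P z $ i $ k / ?x k)))"
    by (simp only: sum_distrib_left[symmetric] distrib_left sum.distrib add_ac)
  also have "\<dots> = weight z n * exit_rate z n"
    unfolding sum_exit_flow d exit_rate_def by (simp only: mult.assoc)
  finally show "((\<lambda>n'. weight z n' * rate (z, n') (z, n)) has_sum weight z n * exit_rate z n) UNIV"
    using rates by simp
qed (simp add: rate_diagonal)

section \<open>The weak invariance equation for kappa\<close>

lemma kappa_nonneg: "0 \<le> jackson_kappa lam mu P \<sigma> s"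
  using weight_pos sigma_pos by (cases s) (simp add: jackson_kappa_def less_imp_le)

lemma kappa_environment_flow:
  assumes "z' \<noteq> z"
  shows "jackson_kappa lam mu P \<sigma> (z, n) * rate (z, n) (z', n) = \<tau> n z z'"
proof -
  have "(\<Prod>i\<in>UNIV. load lam mu P z i powi (- int (n $ i))) = inverse (weight z n)"
    by (simp add: power_int_minus prod_inversef[symmetric] o_def)
  moreover have "weight z n * inverse (weight z n) = 1"
    using weight_pos[of z n] by (intro right_inverse less_imp_neq[symmetric])
  ultimately show ?thesis
    using assms sigma_pos[of z] by (simp add: jackson_kappa_def jackson_rate_def)
qed

lemma WIE_kappa: "WIE (jackson_kappa lam mu P \<sigma>) rate"
  unfolding WIE_def
proof
  fix s :: "'z \<times> (nat ^ 'l)"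
  obtain z n where s: "s = (z, n)" by (cases s)
  let ?\<kappa> = "jackson_kappa lam mu P \<sigma>"
  \<comment> \<open>The common value of the network flows out of and into (z, n).\<close>
  let ?v = "ennreal (1 / \<sigma> z * (weight z n * exit_rate z n))"
  \<comment> \<open>The zero diagonal lets the punctured sums be replaced by the full ones of
    \<open>tau_balanced\<close>.\<close>
  have tau: "(\<Sum>\<^sub>\<infinity>z'\<in>UNIV - {z}. ennreal (\<tau> n z z')) = (\<Sum>\<^sub>\<infinity>z'\<in>UNIV. ennreal (\<tau> n z z'))"
    "(\<Sum>\<^sub>\<infinity>z'\<in>UNIV - {z}. ennreal (\<tau> n z' z)) = (\<Sum>\<^sub>\<infinity>z'\<in>UNIV. ennreal (\<tau> n z' z))"
    by (auto intro!: infsum_cong_neutral simp: tau_diag)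
  have kap: "?\<kappa> (z, n') = 1 / \<sigma> z * weight z n'" for n'
    by (simp add: jackson_kappa_def)
  have "(\<Sum>\<^sub>\<infinity>s'\<in>UNIV - {s}. ennreal (?\<kappa> s * rate s s'))
      = (\<Sum>\<^sub>\<infinity>n'\<in>UNIV - {n}. ennreal (?\<kappa> (z, n) * rate (z, n) (z, n')))
        + (\<Sum>\<^sub>\<infinity>z'\<in>UNIV - {z}. ennreal (?\<kappa> (z, n) * rate (z, n) (z', n)))"
    unfolding s by (rule infsum_ennreal_cross) (simp add: jackson_rate_def)
  also have "(\<Sum>\<^sub>\<infinity>n'\<in>UNIV - {n}. ennreal (?\<kappa> (z, n) * rate (z, n) (z, n'))) = ?v"
    using has_sum_cmult_right[OF network_outflow, of "1 / \<sigma> z"]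
    by (intro infsum_ennreal_eqI mult_nonneg_nonneg kappa_nonneg jackson_rate_nonneg) (simp only: kap mult.assoc)
  also have "(\<Sum>\<^sub>\<infinity>z'\<in>UNIV - {z}. ennreal (?\<kappa> (z, n) * rate (z, n) (z', n)))
      = (\<Sum>\<^sub>\<infinity>z'\<in>UNIV - {z}. ennreal (\<tau> n z z'))"
    by (intro infsum_cong) (simp add: kappa_environment_flow)
  also have "\<dots> = (\<Sum>\<^sub>\<infinity>z'\<in>UNIV - {z}. ennreal (\<tau> n z' z))"
    unfolding tau by (rule tau_balanced)
  \<comment> \<open>The cancellation now takes place in the source environment z', with the loads of
    z' in both the mass and the rate.\<close>
  also have "\<dots> = (\<Sum>\<^sub>\<infinity>z'\<in>UNIV - {z}. ennreal (?\<kappa> (z', n) * rate (z', n) (z, n)))"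
    by (intro infsum_cong) (simp add: kappa_environment_flow)
  also have "?v = (\<Sum>\<^sub>\<infinity>n'\<in>UNIV - {n}. ennreal (?\<kappa> (z, n') * rate (z, n') (z, n)))"
    using has_sum_cmult_right[OF network_inflow, of "1 / \<sigma> z"]
    by (intro infsum_ennreal_eqI[symmetric] mult_nonneg_nonneg kappa_nonneg jackson_rate_nonneg) (simp only: kap mult.assoc)
  also have "\<dots> + (\<Sum>\<^sub>\<infinity>z'\<in>UNIV - {z}. ennreal (?\<kappa> (z', n) * rate (z', n) (z, n)))
      = (\<Sum>\<^sub>\<infinity>s'\<in>UNIV - {s}. ennreal (?\<kappa> s' * rate s' s))"
    unfolding s by (rule infsum_ennreal_cross[symmetric]) (simp add: jackson_rate_def)
  finally show "(\<Sum>\<^sub>\<infinity>s'\<in>UNIV - {s}. ennreal (?\<kappa> s * rate s s'))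
      = (\<Sum>\<^sub>\<infinity>s'\<in>UNIV - {s}. ennreal (?\<kappa> s' * rate s' s))" .
qed

section \<open>Total mass and normalisation\<close>

lemma kappa_mass:
  assumes "\<And>z i. load lam mu P z i < 1"
  shows "(\<integral>\<^sup>+s. ennreal (jackson_kappa lam mu P \<sigma> s) \<partial>count_space UNIV) = jackson_Xi lam mu P \<sigma>"
proof -
  have "(\<Sum>\<^sub>\<infinity>n. ennreal (jackson_kappa lam mu P \<sigma> (z, n)))
      = ennreal (1 / \<sigma> z * (\<Prod>i\<in>UNIV. inverse (1 - load lam mu P z i)))" for z
    using infsum_prod_power[of "load lam mu P z"] assms load_pos sigma_pos[of z]
    by (simp add: jackson_kappa_def ennreal_mult' infsum_cmult_ennreal less_imp_le del: times_divide_eq_left)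
  \<comment> \<open>By Tonelli, summation over configurations comes first; what remains over the
    environments is the series \<open>jackson_Xi\<close>, finite or not.\<close>
  then show ?thesis
    using nn_integral_fst_count_space[of "\<lambda>s. ennreal (jackson_kappa lam mu P \<sigma> s)"]
    by (simp add: nn_integral_count_space_eq_infsum jackson_Xi_def)
qed

lemma Xi_pos:
  assumes "\<And>z i. load lam mu P z i < 1"
  shows "0 < jackson_Xi lam mu P \<sigma>"
proof -
  have "0 < jackson_kappa lam mu P \<sigma> s" for s
    using weight_pos sigma_pos by (cases s) (simp add: jackson_kappa_def)
  \<comment> \<open>\<open>undefined\<close> serves as an arbitrary state: the total mass dominates
    the mass of any single point.\<close>
  then have "0 < ennreal (jackson_kappa lam mu P \<sigma> undefined)"
    by simp
  also have "\<dots> \<le> (\<integral>\<^sup>+s. ennreal (jackson_kappa lam mu P \<sigma> s) \<partial>count_space UNIV)"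
    by (rule nn_integral_ge_point) simp
  finally show ?thesis
    by (simp add: kappa_mass assms)
qed

lemma pi_eq_kappa:
  "jackson_pi lam mu P \<sigma> = (\<lambda>s. 1 / enn2real (jackson_Xi lam mu P \<sigma>) * jackson_kappa lam mu P \<sigma> s)"
  by (auto simp: jackson_pi_def jackson_kappa_def)

lemma pi_prob_space:
  assumes "\<And>z i. load lam mu P z i < 1" and "jackson_Xi lam mu P \<sigma> < \<infinity>"
  shows "prob_space (point_measure UNIV (jackson_pi lam mu P \<sigma>))"
proof (rule prob_spaceI)
  let ?\<Xi> = "enn2real (jackson_Xi lam mu P \<sigma>)"
  \<comment> \<open>\<open>enn2real\<close> sends infinity to 0; finiteness makes the passage to the
    reals faithful, and positivity permits the division.\<close>
  have Xi: "ennreal ?\<Xi> = jackson_Xi lam mu P \<sigma>" "0 < ?\<Xi>"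
    using assms Xi_pos by (auto simp: enn2real_positive_iff)
  have "emeasure (point_measure UNIV (jackson_pi lam mu P \<sigma>)) UNIV
      = (\<integral>\<^sup>+s. ennreal (jackson_pi lam mu P \<sigma> s) \<partial>count_space UNIV)"
    by (simp add: point_measure_def emeasure_density)
  also have "\<dots> = ennreal (1 / ?\<Xi>) * jackson_Xi lam mu P \<sigma>"
    using Xi(2) by (simp only: pi_eq_kappa) (simp add: ennreal_mult' nn_integral_cmult kappa_mass assms del: times_divide_eq_left)
  also have "\<dots> = ennreal (1 / ?\<Xi>) * ennreal ?\<Xi>"
    by (simp only: Xi(1))
  also have "\<dots> = 1"
    using Xi(2) by (simp add: ennreal_mult'[symmetric])
  finally show "emeasure (point_measure UNIV (jackson_pi lam mu P \<sigma>))
      (space (point_measure UNIV (jackson_pi lam mu P \<sigma>))) = 1"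
    by (simp add: space_point_measure)
qed

end

theorem theorem2p1:
  fixes lam mu :: "'z::countable \<Rightarrow> real ^ 'l::finite"
    and P :: "'z \<Rightarrow> real ^ 'l ^ 'l"
    and \<alpha> \<sigma> :: "'z \<Rightarrow> real"
    and \<tau> :: "nat ^ 'l \<Rightarrow> 'z \<Rightarrow> 'z \<Rightarrow> real"
  assumes "jackson_environment lam mu P \<alpha> \<sigma> \<tau>"
  shows "((\<forall>s. 0 \<le> jackson_kappa lam mu P \<sigma> s) \<and>
          WIE (jackson_kappa lam mu P \<sigma>) (jackson_rate lam mu P \<alpha> \<sigma> \<tau>))
       \<and> ((\<forall>z i. load lam mu P z i < 1) \<and> jackson_Xi lam mu P \<sigma> < \<infinity> \<longrightarrow>
          (\<forall>s. 0 \<le> jackson_pi lam mu P \<sigma> s) \<and>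
          prob_space (point_measure UNIV (jackson_pi lam mu P \<sigma>)) \<and>
          WIE (jackson_pi lam mu P \<sigma>) (jackson_rate lam mu P \<alpha> \<sigma> \<tau>))"
proof -
  interpret jackson_environment lam mu P \<alpha> \<sigma> \<tau>
    by (rule assms)
  \<comment> \<open>The equation is homogeneous in the mass function, and pi is a non-negative
    multiple of kappa.\<close>
  have "WIE (jackson_pi lam mu P \<sigma>) rate"
    unfolding pi_eq_kappa by (rule WIE_cmult) (simp_all add: WIE_kappa)
  then show ?thesis
    using WIE_kappa kappa_nonneg pi_prob_space by (auto simp: pi_eq_kappa)
qed

end
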